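(* For all positive integers $n\geq 3$ and $t\geq 1$, $$ar_{bc}(K_n,t)=\begin{cases}\binom{n}{2} & \text{for } n\leq 2t,\\ t(n-1) & \text{for } 2t+1\leq n\leq 2t+3,\\ \binom{n-2}{2}+t & \text{for } n\geq 2t+4.\end{cases}$$
   Context: $K_n$ is the complete (simple) graph on $n$ vertices. A unicyclic subgraph of a graph $G$ is a spanning subgraph (on all of $V(G)$) each of whose connected components contains exactly one cycle. Given a coloring of $E(G)$, a subgraph is rainbow if its edges have pairwise distinct colors. $ar_{bc}(G,t)$ is the maximum number $m$ such that there is a coloring of $E(G)$ with exactly $m$ colors containing no $t$ pairwise edge-disjoint rainbow unicyclic subgraphs. *)

theory Defs
  imports Main "HOL-Library.Ramsey" "HOL-Library.Disjoint_Sets"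
begin

text \<open>A graph is a pair of a vertex set and an edge set; an edge is the set of its two endpoints.\<close>

type_synonym 'a ugraph = "'a set \<times> 'a set set"

abbreviation verts :: "'a ugraph \<Rightarrow> 'a set" where "verts \<equiv> fst"
abbreviation edges :: "'a ugraph \<Rightarrow> 'a set set" where "edges \<equiv> snd"

definition simple_graph :: "'a ugraph \<Rightarrow> bool" where
  "simple_graph G \<longleftrightarrow> edges G \<subseteq> nsets (verts G) 2"

definition complete_graph :: "'a set \<Rightarrow> 'a ugraph" where
  "complete_graph V = (V, nsets V 2)"

definition subgraph :: "'a ugraph \<Rightarrow> 'a ugraph \<Rightarrow> bool" where
  "subgraph H G \<longleftrightarrow> simple_graph H \<and> verts H \<subseteq> verts G \<and> edges H \<subseteq> edges G"

definition spanning_subgraph :: "'a ugraph \<Rightarrow> 'a ugraph \<Rightarrow> bool" where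
  "spanning_subgraph H G \<longleftrightarrow> subgraph H G \<and> verts H = verts G"

definition connected_rel :: "'a ugraph \<Rightarrow> 'a rel" where
  "connected_rel G = {(u, v). u \<in> verts G \<and> v \<in> verts G \<and> (u, v) \<in> {(x, y). {x, y} \<in> edges G}\<^sup>*}"

definition induced_subgraph :: "'a ugraph \<Rightarrow> 'a set \<Rightarrow> 'a ugraph" where
  "induced_subgraph G C = (C, {e \<in> edges G. e \<subseteq> C})"

definition components :: "'a ugraph \<Rightarrow> 'a ugraph set" where
  "components G = induced_subgraph G ` (verts G // connected_rel G)"

text \<open>A cycle is a graph, not a closed walk, so rotating or reversing the vertex list
  gives the same cycle.\<close>

definition is_cycle :: "'a ugraph \<Rightarrow> bool" where
  "is_cycle C \<longleftrightarrow> (\<exists>vs. distinct vs \<and> 3 \<le> length vs \<and>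
     C = (set vs, {{vs ! i, vs ! (Suc i mod length vs)} | i. i < length vs}))"

definition unicyclic_subgraph :: "'a ugraph \<Rightarrow> 'a ugraph \<Rightarrow> bool" where
  "unicyclic_subgraph H G \<longleftrightarrow>
     spanning_subgraph H G \<and> (\<forall>K \<in> components H. \<exists>!C. is_cycle C \<and> subgraph C K)"

definition rainbow :: "('a set \<Rightarrow> nat) \<Rightarrow> 'a ugraph \<Rightarrow> bool" where
  "rainbow c H \<longleftrightarrow> inj_on c (edges H)"

text \<open>Each of the subgraphs is rainbow on its own; different ones may share colors.\<close>

definition has_disjoint_rainbow_unicyclics ::
    "'a ugraph \<Rightarrow> ('a set \<Rightarrow> nat) \<Rightarrow> nat \<Rightarrow> bool" where
  "has_disjoint_rainbow_unicyclics G c t \<longleftrightarrow>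
     (\<exists>H :: nat \<Rightarrow> 'a ugraph.
        (\<forall>i < t. unicyclic_subgraph (H i) G \<and> rainbow c (H i)) \<and>
        disjoint_family_on (\<lambda>i. edges (H i)) {..<t})"

text \<open>For a finite graph the colors may be taken to be natural numbers; only colors that occur
  on an edge are counted. \<open>Max\<close> is meaningful here when \<open>G\<close> is finite and
  nonempty and \<open>t \<ge> 1\<close>: a monochromatic coloring has no rainbow unicyclic subgraph.\<close>

definition ar_bc :: "'a ugraph \<Rightarrow> nat \<Rightarrow> nat" where
  "ar_bc G t = Max {m. \<exists>c :: 'a set \<Rightarrow> nat. card (c ` edges G) = m \<and>
                          \<not> has_disjoint_rainbow_unicyclics G c t}"

end

theory Submission
  imports Defs
begin

text \<open>A spanning subgraph of a complete graph is unicyclic iff its edges can be distributed bijectively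
  among the vertices, every vertex receiving an incident edge (bicircular matroids are transversal).
  Hence \<open>t\<close> disjoint rainbow unicyclic subgraphs amount to a choice of \<open>t\<close> incident edges for every
  vertex, all distinct, in which no color occurs more than \<open>t\<close> times: by Koenig's edge coloring
  theorem for the bipartite multigraph between vertices and colors, such a choice splits into \<open>t\<close>
  rainbow ones. By Rado's theorem the choice exists iff for every vertex set \<open>X\<close> the edges
  meeting \<open>X\<close>, with every color counted at most \<open>t\<close> times, number at least \<open>t * card X\<close>.
  If some color occurs more than \<open>t\<close> times among these edges, the number of colors suffices for this;
  otherwise their plain number does. The extremal colorings violate the condition for
  \<open>X = V\<close> or for some \<open>X\<close> with two elements.\<close>

section \<open>Transversals and bipartite edge colorings\<close>

text \<open>Induction on the total size of the sets. If some \<open>A i\<close> has two elements,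
  one of them can be deleted without losing Hall's condition: a violating subfamily for each of the
  two deletions would contradict submodularity. Once all sets are singletons, the condition for
  \<open>K = J\<close> is the claim.\<close>

lemma rado_transversal:
  fixes r :: "'e set \<Rightarrow> nat" and A :: "'j \<Rightarrow> 'e set"
  assumes "finite J" and fin: "\<And>j. j \<in> J \<Longrightarrow> finite (A j)" and empty: "r {} = 0"
    and mono: "\<And>X Y. finite Y \<Longrightarrow> X \<subseteq> Y \<Longrightarrow> r X \<le> r Y"
    and submod: "\<And>X Y. finite X \<Longrightarrow> finite Y \<Longrightarrow> r (X \<union> Y) + r (X \<inter> Y) \<le> r X + r Y"
    and hall: "\<And>K. K \<subseteq> J \<Longrightarrow> card K \<le> r (\<Union> (A ` K))"
  shows "\<exists>x. (\<forall>j\<in>J. x j \<in> A j) \<and> card J \<le> r (x ` J)"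
  using fin hall
proof (induction "\<Sum>j\<in>J. card (A j)" arbitrary: A rule: less_induct)
  case less
  have ne: "A j \<noteq> {}" if "j \<in> J" for j
    using less.prems(2)[of "{j}"] that empty by auto
  show ?case
  proof (cases "\<forall>j\<in>J. card (A j) \<le> 1")
    case True
    have "\<exists>y. A j = {y}" if "j \<in> J" for j
    proof -
      have "card (A j) \<noteq> 0" using ne[OF that] less.prems(1)[OF that] by simp
      with True that have "card (A j) = 1" by force
      then show ?thesis by (auto simp: card_1_singleton_iff)
    qed
    then obtain x where x: "\<And>j. j \<in> J \<Longrightarrow> A j = {x j}" by metis
    then have "\<Union> (A ` J) = x ` J" by auto
    with less.prems(2)[of J] x show ?thesis by (intro exI[of _ x]) auto
  next
    case False
    then obtain i where i: "i \<in> J" "\<not> card (A i) \<le> Suc 0" by force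
    then obtain y z where yz: "y \<in> A i" "z \<in> A i" "y \<noteq> z"
      using less.prems(1)[of i] by (auto simp: card_le_Suc0_iff_eq)
    define R where "R w = A(i := A i - {w})" for w
    \<comment> \<open>A subfamily violating the condition after the deletion of \<open>w\<close>
      must contain \<open>i\<close>. The set \<open>K\<close> is that subfamily without
      \<open>i\<close>, which turns the strict inequality into \<le>.\<close>
    have shrink: "\<exists>K. K \<subseteq> J - {i} \<and> r (\<Union> (A ` K) \<union> (A i - {w})) \<le> card K"
      if w: "w \<in> A i" and no: "\<not> ?thesis" for w
    proof -
      have finR: "finite (R w j)" if "j \<in> J" for j
        using less.prems(1)[OF that] by (auto simp: R_def)
      have sub: "R w j \<subseteq> A j" for j by (auto simp: R_def)
      have "card (R w i) < card (A i)"
        using w less.prems(1)[OF i(1)] by (simp add: R_def card_gt_0_iff del: card_Diff_insert) (metis card_Diff1_less)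
      then have "(\<Sum>j\<in>J. card (R w j)) < (\<Sum>j\<in>J. card (A j))"
        using i(1) \<open>finite J\<close> by (intro sum_strict_mono_ex1) (auto simp: R_def)
      then have "\<not> (\<forall>K. K \<subseteq> J \<longrightarrow> card K \<le> r (\<Union> (R w ` K)))"
        using less.hyps[of "R w"] finR no sub by (meson subsetD)
      then obtain K where K: "K \<subseteq> J" "r (\<Union> (R w ` K)) < card K" by (meson not_le)
      have iK: "i \<in> K"
      proof (rule ccontr)
        assume "i \<notin> K"
        then have "R w ` K = A ` K" by (auto simp: R_def)
        with K less.prems(2)[of K] show False by simp
      qed
      have "\<Union> (R w ` K) = \<Union> (A ` (K - {i})) \<union> (A i - {w})"
        using iK by (auto simp: R_def split: if_splits)
      moreover have "card K = Suc (card (K - {i}))"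
        using iK K(1) \<open>finite J\<close> by (metis card.remove finite_subset)
      ultimately show ?thesis using K by (intro exI[of _ "K - {i}"]) auto
    qed
    show ?thesis
    proof (rule ccontr)
      assume no: "\<not> ?thesis"
      obtain K where K: "K \<subseteq> J - {i}" "r (\<Union> (A ` K) \<union> (A i - {y})) \<le> card K"
        using shrink[OF yz(1) no] by blast
      obtain L where L: "L \<subseteq> J - {i}" "r (\<Union> (A ` L) \<union> (A i - {z})) \<le> card L"
        using shrink[OF yz(2) no] by blast
      let ?X = "\<Union> (A ` K) \<union> (A i - {y})" and ?Y = "\<Union> (A ` L) \<union> (A i - {z})"
      have fKL: "finite K" "finite L" using K L \<open>finite J\<close> by (auto intro: finite_subset)
      have fXY: "finite ?X" "finite ?Y" using fKL K(1) L(1) i(1) less.prems(1) by auto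
      \<comment> \<open>Since \<open>y \<noteq> z\<close>, the union restores all of
        \<open>A i\<close>, so Hall's condition there counts \<open>i\<close> as well; this surplus
        of one contradicts submodularity.\<close>
      have "?X \<union> ?Y = \<Union> (A ` insert i (K \<union> L))" using yz by auto
      then have "Suc (card (K \<union> L)) \<le> r (?X \<union> ?Y)"
        using less.prems(2)[of "insert i (K \<union> L)"] K(1) L(1) i(1) fKL
        by (metis (no_types, lifting) Diff_subset Un_iff card_insert_disjoint finite_UnI insert_subset
            le_sup_iff subset_Diff_insert subset_trans)
      moreover have "card (K \<inter> L) \<le> r (?X \<inter> ?Y)"
      proof -
        have "card (K \<inter> L) \<le> r (\<Union> (A ` (K \<inter> L)))" using K(1) by (intro less.prems(2)) auto
        also have "\<dots> \<le> r (?X \<inter> ?Y)" using fXY by (intro mono) auto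
        finally show ?thesis .
      qed
      moreover have "card (K \<union> L) + card (K \<inter> L) = card K + card L"
        using fKL by (rule card_Un_Int[symmetric])
      ultimately show False using submod[OF fXY] K(2) L(2) by linarith
    qed
  qed
qed

text \<open>Here \<open>a x\<close> and \<open>b x\<close> are the ends of the edge
  \<open>x\<close>, and \<open>Z\<close> indexes both sides. Induction on the degree: Hall's
  condition yields a perfect matching, which receives a new label, and the remaining edges form a
  regular multigraph of degree one less.\<close>

lemma regular_bipartite_edge_coloring:
  fixes a b :: "'x \<Rightarrow> 'z"
  assumes "finite Z" "finite S" "a ` S \<subseteq> Z" "b ` S \<subseteq> Z"
    and "\<And>z. z \<in> Z \<Longrightarrow> card {x \<in> S. a x = z} = t"
    and "\<And>z. z \<in> Z \<Longrightarrow> card {x \<in> S. b x = z} = t"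
  shows "\<exists>l. \<forall>x\<in>S. l x < t \<and> (\<forall>y\<in>S. x \<noteq> y \<longrightarrow> l x = l y \<longrightarrow> a x \<noteq> a y \<and> b x \<noteq> b y)"
  using assms
proof (induction t arbitrary: S)
  case 0
  have "S = {}"
  proof (rule ccontr)
    assume "S \<noteq> {}"
    then obtain x where "x \<in> S" by blast
    then have "card {y \<in> S. a y = a x} \<noteq> 0" using 0 by auto
    with 0(5)[of "a x"] 0(3) \<open>x \<in> S\<close> show False by auto
  qed
  then show ?case by simp
next
  case (Suc t)
  note finS = Suc.prems(2) and aZ = Suc.prems(3) and bZ = Suc.prems(4)
    and ca = Suc.prems(5) and cb = Suc.prems(6)
  let ?A = "\<lambda>z. {x \<in> S. a x = z}"
  have hall: "card K \<le> card (b ` (\<Union> (?A ` K)))" if "K \<subseteq> Z" for K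
  proof -
    let ?U = "\<Union> (?A ` K)"
    have finK: "finite K" using that Suc.prems(1) finite_subset by blast
    have finU: "finite ?U" using finS by (auto intro: finite_subset[of _ S])
    \<comment> \<open>Double counting: \<open>K\<close> sends out \<open>card K * Suc t\<close>
      edges, and each of their \<open>b\<close>-ends absorbs at most \<open>Suc t\<close> of
      them.\<close>
    have "card K * Suc t = (\<Sum>z\<in>K. card (?A z))" using ca that by (simp add: subset_iff)
    also have "\<dots> = card ?U"
      using finK finS by (intro card_UN_disjoint[symmetric]) auto
    also have "\<dots> = card (\<Union>w\<in>b ` ?U. {x \<in> ?U. b x = w})" by (rule arg_cong[of _ _ card]) auto
    also have "\<dots> \<le> (\<Sum>w\<in>b ` ?U. card {x \<in> ?U. b x = w})" by (rule card_UN_le) (use finU in auto)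
    also have "\<dots> \<le> (\<Sum>w\<in>b ` ?U. Suc t)"
    proof (rule sum_mono)
      fix w assume "w \<in> b ` ?U"
      then have "w \<in> Z" using bZ by auto
      have "card {x \<in> ?U. b x = w} \<le> card {x \<in> S. b x = w}" using finS by (intro card_mono) auto
      then show "card {x \<in> ?U. b x = w} \<le> Suc t" using cb[OF \<open>w \<in> Z\<close>] by simp
    qed
    also have "\<dots> = card (b ` ?U) * Suc t" by simp
    finally show ?thesis by (simp only: mult_le_cancel2)
  qed
  \<comment> \<open>With the number of distinct \<open>b\<close>-ends as \<open>r\<close>, Rado's
    theorem selects one edge per vertex with pairwise different \<open>b\<close>-ends, that is, a
    perfect matching.\<close>
  have "\<exists>x. (\<forall>z\<in>Z. x z \<in> ?A z) \<and> card Z \<le> card (b ` (x ` Z))"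
  proof (rule rado_transversal[where r = "\<lambda>Y. card (b ` Y)"])
    show "card (b ` (X \<union> Y)) + card (b ` (X \<inter> Y)) \<le> card (b ` X) + card (b ` Y)"
      if "finite X" "finite Y" for X Y
    proof -
      have "card (b ` (X \<inter> Y)) \<le> card (b ` X \<inter> b ` Y)" using that by (intro card_mono) auto
      then show ?thesis using card_Un_Int[of "b ` X" "b ` Y"] that by (simp add: image_Un)
    qed
  qed (use Suc.prems(1) finS hall in \<open>auto intro!: card_mono\<close>)
  then obtain x where x: "\<And>z. z \<in> Z \<Longrightarrow> x z \<in> S \<and> a (x z) = z" and "card Z \<le> card (b ` (x ` Z))"
    by blast
  then have "card (b ` (x ` Z)) = card Z"
    using Suc.prems(1) by (metis card_image_le finite_imageI image_image le_antisym)
  moreover have "b ` (x ` Z) \<subseteq> Z" using x bZ by auto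
  ultimately have bxZ: "(\<lambda>z. b (x z)) ` Z = Z"
    using Suc.prems(1) card_subset_eq[of Z "b ` (x ` Z)"] by (simp add: image_image)
  then have bx_inj: "inj_on (\<lambda>z. b (x z)) Z"
    using Suc.prems(1) by (simp add: eq_card_imp_inj_on)
  define T where "T = S - x ` Z"
  have ca': "card {y \<in> T. a y = z} = t" if "z \<in> Z" for z
  proof -
    have "{y \<in> T. a y = z} = {y \<in> S. a y = z} - {x z}" using x that by (auto simp: T_def)
    then show ?thesis using ca[OF that] x[OF that] by simp
  qed
  have cb': "card {y \<in> T. b y = z} = t" if "z \<in> Z" for z
  proof -
    have "z \<in> (\<lambda>z. b (x z)) ` Z" using that bxZ by simp
    then obtain w where w: "w \<in> Z" "b (x w) = z" by auto
    have "{y \<in> T. b y = z} = {y \<in> S. b y = z} - {x w}"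
      using w bx_inj by (auto simp: T_def inj_on_def)
    then show ?thesis using cb[OF that] x[OF w(1)] w by simp
  qed
  have "\<exists>l. \<forall>u\<in>T. l u < t \<and> (\<forall>y\<in>T. u \<noteq> y \<longrightarrow> l u = l y \<longrightarrow> a u \<noteq> a y \<and> b u \<noteq> b y)"
    using finS aZ bZ Suc.prems(1) ca' cb' by (intro Suc.IH) (auto simp: T_def)
  then obtain l where l: "\<forall>u\<in>T. l u < t \<and> (\<forall>y\<in>T. u \<noteq> y \<longrightarrow> l u = l y \<longrightarrow> a u \<noteq> a y \<and> b u \<noteq> b y)"
    by blast
  have xx: "a u \<noteq> a y \<and> b u \<noteq> b y" if "u \<in> x ` Z" "y \<in> x ` Z" "u \<noteq> y" for u y
    using that x bx_inj by (auto simp: inj_on_def)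
  let ?l = "\<lambda>u. if u \<in> x ` Z then t else l u"
  have "?l u < Suc t \<and> (\<forall>y\<in>S. u \<noteq> y \<longrightarrow> ?l u = ?l y \<longrightarrow> a u \<noteq> a y \<and> b u \<noteq> b y)"
    if u: "u \<in> S" for u
  proof (cases "u \<in> x ` Z")
    case True
    then show ?thesis using xx l by (auto simp: T_def simp del: image_iff)
  next
    case False
    then have "u \<in> T" using u by (simp add: T_def)
    then have lu: "l u < t" "\<And>y. y \<in> T \<Longrightarrow> u \<noteq> y \<Longrightarrow> l u = l y \<Longrightarrow> a u \<noteq> a y \<and> b u \<noteq> b y"
      using l by blast+
    have "a u \<noteq> a y \<and> b u \<noteq> b y" if "y \<in> S" "u \<noteq> y" "?l u = ?l y" for y
    proof (cases "y \<in> x ` Z")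
      case True
      then show ?thesis using that False lu(1) by simp
    next
      case nF: False
      then show ?thesis using that False lu(2)[of y] by (simp add: T_def)
    qed
    then show ?thesis using lu(1) False by simp
  qed
  then show ?case by (intro exI[of _ ?l] ballI) blast
qed

text \<open>Koenig's theorem. To make a bipartite multigraph regular, take a second copy with the sides
  exchanged and join every vertex to its twin by as many parallel edges as its degree is
  below \<open>t\<close>.\<close>

lemma bipartite_edge_coloring:
  fixes a :: "'x \<Rightarrow> 'u" and b :: "'x \<Rightarrow> 'w"
  assumes finS: "finite S"
    and ca: "\<And>u. card {x \<in> S. a x = u} \<le> t" and cb: "\<And>w. card {x \<in> S. b x = w} \<le> t"
  shows "\<exists>l. \<forall>x\<in>S. l x < t \<and> (\<forall>y\<in>S. x \<noteq> y \<longrightarrow> l x = l y \<longrightarrow> a x \<noteq> a y \<and> b x \<noteq> b y)"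
proof -
  define Z where "Z = Inl ` a ` S \<union> Inr ` b ` S"
  define deg where "deg z = (case z of Inl u \<Rightarrow> card {x \<in> S. a x = u} | Inr w \<Rightarrow> card {x \<in> S. b x = w})"
    for z
  define Links where "Links = (SIGMA z:Z. {..<t - deg z})"
  \<comment> \<open>\<open>Inl (x, False)\<close> is the edge \<open>x\<close> itself,
    \<open>Inl (x, True)\<close> its copy with the sides exchanged, and \<open>Inr (z, i)\<close>
    one of the parallel edges from \<open>z\<close> to its twin, which bears the same name
    \<open>z\<close> on the other side.\<close>
  define S' where "S' = Inl ` (S \<times> (UNIV :: bool set)) \<union> Inr ` Links"
  define a' where "a' y = (case y of Inl (x, d) \<Rightarrow> if d then Inr (b x) else Inl (a x) | Inr (z, i) \<Rightarrow> z)"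
    for y :: "('x \<times> bool) + (('u + 'w) \<times> nat)"
  define b' where "b' y = (case y of Inl (x, d) \<Rightarrow> if d then Inl (a x) else Inr (b x) | Inr (z, i) \<Rightarrow> z)"
    for y :: "('x \<times> bool) + (('u + 'w) \<times> nat)"
  have deg: "deg z \<le> t" for z using ca cb by (auto simp: deg_def split: sum.split)
  have finZ: "finite Z" using finS by (simp add: Z_def)
  have finS': "finite S'" using finS finZ by (simp add: S'_def Links_def finite_cartesian_product)
  have card_fibre: "card (Inl ` ((\<lambda>x. (x, d)) ` P) \<union> Inr ` ((\<lambda>i. (z, i)) ` {..<k})
      :: (('x \<times> bool) + (('u + 'w) \<times> nat)) set) = card P + k"
    if "finite P" for P d z and k :: nat
  proof -
    have "card (Inl ` ((\<lambda>x. (x, d)) ` P) :: (('x \<times> bool) + (('u + 'w) \<times> nat)) set) = card P"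
      by (simp add: card_image inj_on_def)
    moreover have "card (Inr ` ((\<lambda>i. (z, i)) ` {..<k}) :: (('x \<times> bool) + (('u + 'w) \<times> nat)) set) = k"
      by (simp add: card_image inj_on_def)
    moreover have "card (Inl ` ((\<lambda>x. (x, d)) ` P) \<union> Inr ` ((\<lambda>i. (z, i)) ` {..<k})
      :: (('x \<times> bool) + (('u + 'w) \<times> nat)) set) =
      card (Inl ` ((\<lambda>x. (x, d)) ` P) :: (('x \<times> bool) + (('u + 'w) \<times> nat)) set) +
      card (Inr ` ((\<lambda>i. (z, i)) ` {..<k}) :: (('x \<times> bool) + (('u + 'w) \<times> nat)) set)"
      by (rule card_Un_disjoint) (use that in auto)
    ultimately show ?thesis by simp
  qed
  have ra: "card {y \<in> S'. a' y = z} = t" if "z \<in> Z" for z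
  proof (cases z)
    case (Inl u)
    have "{y \<in> S'. a' y = z} =
        Inl ` ((\<lambda>x. (x, False)) ` {x \<in> S. a x = u}) \<union> Inr ` ((\<lambda>i. (z, i)) ` {..<t - deg z})"
      using that Inl by (auto simp: S'_def a'_def Links_def split: if_splits)
    then show ?thesis using card_fibre[of "{x \<in> S. a x = u}"] deg[of z] finS Inl by (simp add: deg_def)
  next
    case (Inr w)
    have "{y \<in> S'. a' y = z} =
        Inl ` ((\<lambda>x. (x, True)) ` {x \<in> S. b x = w}) \<union> Inr ` ((\<lambda>i. (z, i)) ` {..<t - deg z})"
      using that Inr by (auto simp: S'_def a'_def Links_def split: if_splits)
    then show ?thesis using card_fibre[of "{x \<in> S. b x = w}"] deg[of z] finS Inr by (simp add: deg_def)
  qed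
  have rb: "card {y \<in> S'. b' y = z} = t" if "z \<in> Z" for z
  proof (cases z)
    case (Inl u)
    have "{y \<in> S'. b' y = z} =
        Inl ` ((\<lambda>x. (x, True)) ` {x \<in> S. a x = u}) \<union> Inr ` ((\<lambda>i. (z, i)) ` {..<t - deg z})"
      using that Inl by (auto simp: S'_def b'_def Links_def split: if_splits)
    then show ?thesis using card_fibre[of "{x \<in> S. a x = u}"] deg[of z] finS Inl by (simp add: deg_def)
  next
    case (Inr w)
    have "{y \<in> S'. b' y = z} =
        Inl ` ((\<lambda>x. (x, False)) ` {x \<in> S. b x = w}) \<union> Inr ` ((\<lambda>i. (z, i)) ` {..<t - deg z})"
      using that Inr by (auto simp: S'_def b'_def Links_def split: if_splits)
    then show ?thesis using card_fibre[of "{x \<in> S. b x = w}"] deg[of z] finS Inr by (simp add: deg_def)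
  qed
  have "a' ` S' \<subseteq> Z" "b' ` S' \<subseteq> Z"
    by (auto simp: S'_def a'_def b'_def Links_def Z_def)
  from regular_bipartite_edge_coloring[OF finZ finS' this ra rb]
  obtain l where l: "\<forall>x\<in>S'. l x < t \<and>
      (\<forall>y\<in>S'. x \<noteq> y \<longrightarrow> l x = l y \<longrightarrow> a' x \<noteq> a' y \<and> b' x \<noteq> b' y)"
    by blast
  have "l (Inl (x, False)) < t \<and> (\<forall>y\<in>S. x \<noteq> y \<longrightarrow> l (Inl (x, False)) = l (Inl (y, False)) \<longrightarrow>
      a x \<noteq> a y \<and> b x \<noteq> b y)" if "x \<in> S" for x
  proof -
    have *: "Inl (x, False) \<in> S'" if "x \<in> S" for x using that by (simp add: S'_def)
    show ?thesis using bspec[OF l *[OF that]] * by (fastforce simp: a'_def b'_def)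
  qed
  then show ?thesis by (intro exI[of _ "\<lambda>x. l (Inl (x, False))"]) blast
qed

section \<open>Unicyclic subgraphs as edge choices\<close>

text \<open>Sending each vertex to the other end of its chosen edge turns an edge choice into a
  function. Injectivity of the choice excludes orbits of period two, so that every periodic orbit is
  a genuine cycle.\<close>

locale functional_graph =
  fixes V :: "'a set" and f :: "'a \<Rightarrow> 'a"
  assumes fin: "finite V" and closed: "v \<in> V \<Longrightarrow> f v \<in> V" and irrefl: "v \<in> V \<Longrightarrow> f v \<noteq> v"
    and inj: "inj_on (\<lambda>v. {v, f v}) V"
begin

definition graph :: "'a ugraph" where
  "graph = (V, (\<lambda>v. {v, f v}) ` V)"

lemma f_f_neq: "f (f v) \<noteq> v" if "v \<in> V"
  using inj_onD[OF inj, of v "f v"] closed irrefl that by (metis insert_commute)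

lemma funpow_closed: "v \<in> V \<Longrightarrow> (f ^^ i) v \<in> V"
  by (induction i) (auto simp: closed)

lemma edge_in: "v \<in> V \<Longrightarrow> {v, f v} \<in> nsets V 2"
  using closed[of v] irrefl[of v] by (auto simp: nsets_def card_insert_if)

lemma edge_cases: "{x, y} \<in> edges graph \<Longrightarrow> y = f x \<or> x = f y"
  by (auto simp: graph_def doubleton_eq_iff)

text \<open>One end of each edge is the image of the other, so stepping along an edge preserves the
  property that the forward orbits eventually coincide.\<close>

lemma connected_orbits_meet:
  assumes "(u, w) \<in> {(x, y). {x, y} \<in> edges graph}\<^sup>*"
  shows "\<exists>i j. (f ^^ i) u = (f ^^ j) w"
  using assms
proof (induction rule: rtrancl_induct)
  case base
  then show ?case by blast
next
  case (step y z)
  then obtain i j where ij: "(f ^^ i) u = (f ^^ j) y" by blast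
  from step(2) consider "z = f y" | "y = f z" using edge_cases by blast
  then show ?case
  proof cases
    case 1
    then have "(f ^^ Suc i) u = (f ^^ j) z" using ij by (simp add: funpow_swap1)
    then show ?thesis by blast
  next
    case 2
    then have "(f ^^ i) u = (f ^^ Suc j) z" using ij by (simp add: funpow_swap1)
    then show ?thesis by blast
  qed
qed

lemma orbit_connected:
  assumes "v \<in> V"
  shows "(v, (f ^^ i) v) \<in> {(x, y). {x, y} \<in> edges graph}\<^sup>*"
proof (induction i)
  case (Suc i)
  have "{(f ^^ i) v, (f ^^ Suc i) v} \<in> edges graph"
    using funpow_closed[OF assms, of i] by (auto simp: graph_def)
  then show ?case using Suc by (simp add: rtrancl_into_rtrancl)
qed simp

text \<open>Every edge of the cycle is an arc of \<open>f\<close> in one of two directions. As a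
  vertex has only one image, all arcs must run the same way around, so the cycle is the forward
  orbit of any of its vertices.\<close>

lemma cycle_is_orbit:
  assumes cyc: "is_cycle C" and sub: "subgraph C graph" and v: "v \<in> verts C"
  shows "C = (range (\<lambda>i. (f ^^ i) v), (\<lambda>u. {u, f u}) ` range (\<lambda>i. (f ^^ i) v))"
proof -
  obtain vs where vs: "distinct vs" "3 \<le> length vs"
    and C: "C = (set vs, {{vs ! i, vs ! (Suc i mod length vs)} | i. i < length vs})"
    using cyc unfolding is_cycle_def by blast
  define L where "L = length vs"
  \<comment> \<open>The periodic extension of the vertex list, which removes the special case of the
    closing edge.\<close>
  define s where "s i = vs ! (i mod L)" for i
  have L: "3 \<le> L" using vs L_def by simp
  have per: "s (i + k * L) = s i" for i k by (simp add: s_def)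
  have rng: "set vs = range s"
  proof
    show "set vs \<subseteq> range s"
    proof
      fix x assume "x \<in> set vs"
      then obtain i where "i < L" "x = vs ! i" by (auto simp: in_set_conv_nth L_def)
      then have "x = s i" by (simp add: s_def)
      then show "x \<in> range s" by blast
    qed
    have "i mod L < length vs" for i using L by (simp add: L_def flip: length_greater_0_conv)
    then show "range s \<subseteq> set vs" by (auto simp: s_def)
  qed
  have edg: "edges C = range (\<lambda>i. {s i, s (Suc i)})"
  proof
    show "edges C \<subseteq> range (\<lambda>i. {s i, s (Suc i)})"
    proof
      fix e assume "e \<in> edges C"
      then obtain i where i: "i < L" "e = {vs ! i, vs ! (Suc i mod L)}" by (auto simp: C L_def)
      then have "e = {s i, s (Suc i)}" by (simp add: s_def)
      then show "e \<in> range (\<lambda>i. {s i, s (Suc i)})" by blast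
    qed
    show "range (\<lambda>i. {s i, s (Suc i)}) \<subseteq> edges C"
    proof clarify
      fix i
      have "{s i, s (Suc i)} = {vs ! (i mod L), vs ! (Suc (i mod L) mod L)}"
        by (simp add: s_def mod_Suc_eq)
      moreover have "i mod L < length vs" using L by (simp add: L_def flip: length_greater_0_conv)
      ultimately show "{s i, s (Suc i)} \<in> edges C" by (auto simp: C L_def)
    qed
  qed
  \<comment> \<open>The two neighbours of a vertex on the cycle differ; this is where length at
    least 3 enters.\<close>
  have s2: "s j \<noteq> s (j + 2)" for j
  proof
    assume "s j = s (j + 2)"
    moreover have "j mod L < length vs" "(j + 2) mod L < length vs"
      using L by (simp_all add: L_def flip: length_greater_0_conv)
    ultimately have "j mod L = (j + 2) mod L"
      using vs(1) by (simp add: s_def nth_eq_iff_index_eq)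
    then have "L dvd 2" by (metis add_diff_cancel_left' le_add1 mod_eq_dvd_iff_nat)
    then show False using L by (auto dest: dvd_imp_le)
  qed
  have dir: "f (s i) = s (Suc i) \<or> f (s (Suc i)) = s i" for i
  proof -
    have "{s i, s (Suc i)} \<in> edges graph" using sub edg by (auto simp: subgraph_def)
    then show ?thesis using edge_cases by metis
  qed
  obtain k where k: "v = s k" using v C rng by auto
  have "range (\<lambda>i. (f ^^ i) v) = range s \<and> (\<lambda>u. {u, f u}) ` range s = range (\<lambda>i. {s i, s (Suc i)})"
  proof (cases "\<exists>j. f (s (Suc j)) = s j")
    case True
    then obtain j where j: "f (s (Suc j)) = s j" by blast
    \<comment> \<open>A backward arc forces the next arc to be backward too, hence all of them.\<close>
    have up: "f (s (Suc (j + i))) = s (j + i)" for i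
    proof (induction i)
      case (Suc i)
      then have "f (s (Suc (j + i))) \<noteq> s (Suc (Suc (j + i)))" using s2[of "j + i"] by simp
      then show ?case using dir[of "Suc (j + i)"] by simp
    qed (simp add: j)
    \<comment> \<open>Adding \<open>j * L\<close> leaves \<open>s i\<close> unchanged and moves the
      index beyond \<open>j\<close>, into the range of \<open>up\<close>.\<close>
    have down: "f (s (Suc i)) = s i" for i
    proof -
      have "j \<le> i + j * L" using L by (simp add: trans_le_add2)
      then obtain d where d: "i + j * L = j + d" using le_Suc_ex by blast
      then have "s (Suc i) = s (Suc (j + d))" using per[of "Suc i" j] by simp
      then show ?thesis using up[of d] per[of i j] d by simp
    qed
    have pow: "(f ^^ i) (s (j + i)) = s j" for i j
    proof (induction i)
      case (Suc i)
      then show ?case using down[of "j + i"] by (simp add: funpow_swap1)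
    qed simp
    \<comment> \<open>Modulo \<open>L\<close>, adding \<open>i * (L - 1)\<close> subtracts
      \<open>i\<close>, so \<open>i\<close> steps backward can be written without leaving the
      natural numbers.\<close>
    have L1: "x * L = x * (L - 1) + x" for x using L by (cases L) auto
    have "(f ^^ i) v = s (k + i * (L - 1))" for i
      using pow[of i "k + i * (L - 1)"] per[of k i] by (simp add: k L1 add.assoc)
    moreover have "s i = (f ^^ (k + i * (L - 1))) v" for i
    proof -
      have "i + (k + i * (L - 1)) = k + i * L" by (simp add: L1)
      then show ?thesis using pow[of "k + i * (L - 1)" i] per[of k i] by (metis k)
    qed
    ultimately have "range (\<lambda>i. (f ^^ i) v) = range s" by blast
    moreover have "{s i, f (s i)} = {s (i + (L - 1)), s (Suc (i + (L - 1)))}" for i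
    proof -
      have "Suc (i + (L - 1)) = i + 1 * L" using L by simp
      then have "s (Suc (i + (L - 1))) = s i" using per[of i 1] by metis
      then show ?thesis using down[of "i + (L - 1)"] by auto
    qed
    moreover have "{s i, s (Suc i)} = {s (Suc i), f (s (Suc i))}" for i using down[of i] by auto
    ultimately show ?thesis by auto
  next
    case False
    then have fwd: "f (s i) = s (Suc i)" for i using dir by blast
    have pow: "(f ^^ i) (s j) = s (j + i)" for i j
      by (induction i) (auto simp: fwd)
    \<comment> \<open>Starting from index \<open>k\<close>, these many forward steps end at
      \<open>i + k * L\<close>, which is \<open>i\<close> modulo \<open>L\<close>.\<close>
    have "s i = (f ^^ (i + k * (L - 1))) v" for i
    proof -
      have "k + (i + k * (L - 1)) = i + k * L" using L by (cases L) auto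
      then show ?thesis using pow[of "i + k * (L - 1)" k] per[of i k] by (metis k)
    qed
    moreover have "(f ^^ i) v = s (k + i)" for i by (simp add: k pow)
    ultimately have "range (\<lambda>i. (f ^^ i) v) = range s" by blast
    then show ?thesis by (auto simp: fwd)
  qed
  moreover have "C = (range s, range (\<lambda>i. {s i, s (Suc i)}))"
    using edg rng by (simp add: C)
  ultimately show ?thesis by simp
qed

text \<open>By finiteness the orbit of \<open>v\<close> reaches a periodic point \<open>p\<close>.
  Its least period is neither 1, as \<open>f\<close> has no fixed points, nor 2, by
  \<open>f_f_neq\<close>.\<close>

lemma exists_cycle:
  assumes v: "v \<in> V"
  shows "\<exists>C. is_cycle C \<and> edges C = (\<lambda>u. {u, f u}) ` verts C \<and> verts C \<subseteq> range (\<lambda>i. (f ^^ i) v) \<and>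
    f ` verts C \<subseteq> verts C"
proof -
  have "range (\<lambda>i. (f ^^ i) v) \<subseteq> V" using funpow_closed[OF v] by auto
  then have "\<not> inj (\<lambda>i. (f ^^ i) v)"
    using fin by (metis finite_subset infinite_UNIV_nat finite_imageD)
  then obtain i j where "i < j" and eq: "(f ^^ i) v = (f ^^ j) v"
    by (metis (no_types, lifting) injI linorder_neqE_nat)
  define p where "p = (f ^^ i) v"
  have pV: "p \<in> V" using funpow_closed[OF v] by (simp add: p_def)
  define P where "P m \<longleftrightarrow> 0 < m \<and> (f ^^ m) p = p" for m
  define L where "L = (LEAST m. P m)"
  have "(f ^^ (j - i + i)) v = (f ^^ (j - i)) p" by (simp only: p_def funpow_add comp_apply)
  then have "P (j - i)" using \<open>i < j\<close> eq by (simp add: P_def p_def)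
  then have PL: "P L" unfolding L_def by (rule LeastI)
  have least: "\<not> P m" if "m < L" for m using that not_less_Least unfolding L_def by blast
  have L0: "0 < L" and Lp: "(f ^^ L) p = p" using PL by (auto simp: P_def)
  have "L \<noteq> 1" using Lp irrefl[OF pV] by auto
  moreover have "L \<noteq> 2" using Lp f_f_neq[OF pV] by (auto simp: numeral_2_eq_2)
  ultimately have L3: "3 \<le> L" using L0 by linarith
  define vs where "vs = map (\<lambda>i. (f ^^ i) p) [0..<L]"
  have len: "length vs = L" by (simp add: vs_def)
  \<comment> \<open>Applying \<open>f\<close> another \<open>L - b\<close> times to a repetition
    would give \<open>p\<close> the smaller period \<open>L - b + a\<close>.\<close>
  have neq: "(f ^^ a) p \<noteq> (f ^^ b) p" if "a < b" "b < L" for a b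
  proof
    assume "(f ^^ a) p = (f ^^ b) p"
    then have "(f ^^ (L - b + a)) p = (f ^^ (L - b + b)) p" by (simp only: funpow_add comp_apply)
    then have "P (L - b + a)" using that Lp by (simp add: P_def)
    then show False using least[of "L - b + a"] that by linarith
  qed
  have dist: "distinct vs"
    unfolding vs_def distinct_map by (auto simp: inj_on_def) (metis neq linorder_neqE_nat)
  have nxt: "vs ! (Suc i mod L) = f (vs ! i)" if "i < L" for i
  proof (cases "Suc i = L")
    case True
    then have "f ((f ^^ i) p) = p" using Lp by auto
    then show ?thesis using True that L0 by (simp add: vs_def)
  qed (use that in \<open>simp add: vs_def\<close>)
  have st: "set vs = (!) vs ` {..<L}" by (auto simp: set_conv_nth len)
  have E: "{{vs ! i, vs ! (Suc i mod length vs)} | i. i < length vs} = (\<lambda>u. {u, f u}) ` set vs"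
    using nxt by (force simp: len st)
  have "is_cycle (set vs, (\<lambda>u. {u, f u}) ` set vs)"
    unfolding is_cycle_def using dist L3 len E by (intro exI[of _ vs]) auto
  moreover have "set vs \<subseteq> range (\<lambda>i. (f ^^ i) v)"
    by (auto simp: vs_def p_def) (metis comp_apply funpow_add rangeI)
  moreover have "f u \<in> set vs" if "u \<in> set vs" for u
  proof -
    from that obtain i where "i < L" "u = vs ! i" by (auto simp: st)
    then have "f u = vs ! (Suc i mod L)" "Suc i mod L < length vs" using nxt len L0 by auto
    then show ?thesis by simp
  qed
  ultimately show ?thesis by (intro exI[of _ "(set vs, (\<lambda>u. {u, f u}) ` set vs)"]) auto
qed

text \<open>A cycle in the component of \<open>v\<close> is found on the orbit of \<open>v\<close>.
  Two cycles in one component contain a common point, because orbits of their vertices meet and stay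
  inside the cycles; both are the orbit of that point.\<close>

lemma unicyclic: "unicyclic_subgraph graph (complete_graph V)"
  unfolding unicyclic_subgraph_def
proof
  have simp_graph: "edges graph \<subseteq> nsets V 2" using edge_in by (auto simp: graph_def)
  then show "spanning_subgraph graph (complete_graph V)"
    by (auto simp: spanning_subgraph_def subgraph_def simple_graph_def complete_graph_def graph_def)
  show "\<forall>K\<in>components graph. \<exists>!C. is_cycle C \<and> subgraph C K"
  proof
    fix K assume "K \<in> components graph"
    then obtain v where v: "v \<in> V" and K: "K = induced_subgraph graph (connected_rel graph `` {v})"
      by (auto simp: components_def quotient_def graph_def)
    let ?W = "connected_rel graph `` {v}"
    have Wv: "(v, u) \<in> {(x, y). {x, y} \<in> edges graph}\<^sup>*" if "u \<in> ?W" for u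
      using that by (auto simp: connected_rel_def)
    have WV: "?W \<subseteq> V" by (auto simp: connected_rel_def graph_def)
    have orbW: "(f ^^ i) v \<in> ?W" for i
      using orbit_connected[OF v, of i] funpow_closed[OF v] v by (auto simp: connected_rel_def graph_def)
    obtain C where C: "is_cycle C" "edges C = (\<lambda>u. {u, f u}) ` verts C"
      "verts C \<subseteq> range (\<lambda>i. (f ^^ i) v)" "f ` verts C \<subseteq> verts C"
      using exists_cycle[OF v] by blast
    have CV: "verts C \<subseteq> ?W" using C(3) orbW by auto
    have "edges C \<subseteq> nsets (verts C) 2"
    proof
      fix e assume "e \<in> edges C"
      then obtain u where u: "u \<in> verts C" "e = {u, f u}" using C(2) by auto
      then have "e \<in> nsets V 2" using edge_in CV WV by auto
      then show "e \<in> nsets (verts C) 2" using u C(4) by (auto simp: nsets_def)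
    qed
    moreover have "edges C \<subseteq> {e \<in> edges graph. e \<subseteq> ?W}"
      using C(2,4) CV WV by (auto simp: graph_def)
    ultimately have CK: "subgraph C K"
      using CV by (auto simp: subgraph_def simple_graph_def K induced_subgraph_def)
    have lift: "subgraph B graph \<and> verts B \<subseteq> ?W" if "subgraph B K" for B
      using that WV by (auto simp: subgraph_def K induced_subgraph_def graph_def)
    show "\<exists>!C. is_cycle C \<and> subgraph C K"
    proof (rule ex1I)
      show "is_cycle C \<and> subgraph C K" using C(1) CK by blast
    next
      fix D assume D: "is_cycle D \<and> subgraph D K"
      have Cg: "subgraph C graph" and Dg: "subgraph D graph" and Dc: "is_cycle D"
        using lift CK D by auto
      have ne: "verts B \<noteq> {}" if "is_cycle B" for B :: "'a ugraph"
        using that by (auto simp: is_cycle_def)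
      obtain u w where u: "u \<in> verts C" and w: "w \<in> verts D" using ne C(1) D by blast
      have "sym {(x, y). {x, y} \<in> edges graph}" by (auto simp: sym_def insert_commute)
      then have "(u, w) \<in> {(x, y). {x, y} \<in> edges graph}\<^sup>*"
        using Wv u w CV lift[of D] D by (meson rtrancl_trans subsetD sym_rtrancl symD)
      then obtain i j where ij: "(f ^^ i) u = (f ^^ j) w" using connected_orbits_meet by blast
      let ?p = "(f ^^ i) u"
      have "verts C = range (\<lambda>i. (f ^^ i) u)" by (subst cycle_is_orbit[OF C(1) Cg u]) simp
      then have "?p \<in> verts C" by blast
      note p1 = cycle_is_orbit[OF C(1) Cg this]
      have "verts D = range (\<lambda>i. (f ^^ i) w)" by (subst cycle_is_orbit[OF Dc Dg w]) simp
      then have "?p \<in> verts D" using ij by auto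
      note p2 = cycle_is_orbit[OF Dc Dg this]
      show "D = C" by (rule trans[OF p2 p1[symmetric]])
    qed
  qed
qed

end

lemma unicyclic_if_edge_choice:
  assumes "finite V" and "inj_on \<phi> V" and "\<And>v. v \<in> V \<Longrightarrow> \<phi> v \<in> nsets V 2 \<and> v \<in> \<phi> v"
  shows "unicyclic_subgraph (V, \<phi> ` V) (complete_graph V)"
proof -
  have "\<exists>w. \<phi> v = {v, w} \<and> w \<noteq> v \<and> w \<in> V" if "v \<in> V" for v
    using assms(3)[OF that] by (auto simp: nsets_def card_2_iff)
  then obtain f where f: "\<And>v. v \<in> V \<Longrightarrow> \<phi> v = {v, f v} \<and> f v \<noteq> v \<and> f v \<in> V" by metis
  have "inj_on (\<lambda>v. {v, f v}) V" using assms(2) f by (metis (no_types, lifting) inj_on_cong)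
  then interpret functional_graph V f
    by unfold_locales (use assms(1) f in auto)
  have "\<phi> ` V = (\<lambda>v. {v, f v}) ` V" using f by auto
  then show ?thesis using unicyclic by (simp add: graph_def)
qed

text \<open>A maximal vertex set admitting an edge choice inside itself is closed under adjacency and meets
  every cycle, so it is everything.\<close>

lemma edge_choice_if_unicyclic:
  assumes fin: "finite V" and H: "unicyclic_subgraph H (complete_graph V)"
  shows "\<exists>\<phi>. inj_on \<phi> V \<and> (\<forall>v\<in>V. \<phi> v \<in> edges H \<and> v \<in> \<phi> v)"
proof -
  \<comment> \<open>Requiring the chosen edges to lie inside \<open>A\<close> keeps edges that leave
    \<open>A\<close> available for extensions.\<close>
  define good where "good A \<longleftrightarrow> A \<subseteq> V \<and>
    (\<exists>\<phi>. inj_on \<phi> A \<and> (\<forall>v\<in>A. v \<in> \<phi> v \<and> \<phi> v \<in> edges H \<and> \<phi> v \<subseteq> A))" for A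
  have VH: "verts H = V" and EH: "edges H \<subseteq> nsets V 2"
    using H by (auto simp: unicyclic_subgraph_def spanning_subgraph_def subgraph_def complete_graph_def)
  \<comment> \<open>Every vertex of a cycle takes the edge to its successor. Two such edges could
    coincide only on a cycle of length two.\<close>
  have good_cycle: "good (verts C)" if "is_cycle C" "subgraph C H" for C
  proof -
    obtain vs where vs: "distinct vs" "3 \<le> length vs"
      and C: "C = (set vs, {{vs ! i, vs ! (Suc i mod length vs)} | i. i < length vs})"
      using \<open>is_cycle C\<close> unfolding is_cycle_def by blast
    define e where "e i = {vs ! i, vs ! (Suc i mod length vs)}" for i
    define ix where "ix = the_inv_into {..<length vs} ((!) vs)"
    have bij: "bij_betw ((!) vs) {..<length vs} (set vs)" using vs(1) by (intro bij_betw_nth) auto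
    have ix: "ix u < length vs" "vs ! ix u = u" if "u \<in> set vs" for u
      using that bij the_inv_into_into[of "(!) vs" "{..<length vs}" u "{..<length vs}"]
        f_the_inv_into_f_bij_betw[OF bij, of u]
      by (auto simp: ix_def bij_betw_def)
    have inje: "i = j" if "e i = e j" "i < length vs" "j < length vs" for i j
    proof (rule ccontr)
      assume "i \<noteq> j"
      have "0 < length vs" using vs(2) by linarith
      then have m: "Suc i mod length vs < length vs" "Suc j mod length vs < length vs" by auto
      have "vs ! i \<noteq> vs ! j" using \<open>i \<noteq> j\<close> that vs(1) by (simp add: nth_eq_iff_index_eq)
      then have "vs ! i = vs ! (Suc j mod length vs)" "vs ! (Suc i mod length vs) = vs ! j"
        using that(1) by (auto simp: e_def doubleton_eq_iff)
      then have "i = Suc j mod length vs" "j = Suc i mod length vs"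
        using that vs(1) m by (auto simp: nth_eq_iff_index_eq)
      moreover have "Suc m mod length vs = (if Suc m = length vs then 0 else Suc m)"
        if "m < length vs" for m using that by auto
      ultimately show False using that(2,3) vs(2) by (auto split: if_splits)
    qed
    have "inj_on (\<lambda>u. e (ix u)) (set vs)"
      by (rule inj_onI) (metis inje ix)
    moreover have "u \<in> e (ix u) \<and> e (ix u) \<in> edges H \<and> e (ix u) \<subseteq> set vs" if "u \<in> set vs" for u
    proof -
      have "e (ix u) \<in> edges C" using ix(1)[OF that] unfolding C e_def by auto
      moreover have "Suc (ix u) mod length vs < length vs"
        using vs(2) by (simp flip: length_greater_0_conv)
      ultimately show ?thesis using ix[OF that] \<open>subgraph C H\<close> that
        by (auto simp: e_def subgraph_def)
    qed
    moreover have "set vs \<subseteq> V" using \<open>subgraph C H\<close> VH C by (auto simp: subgraph_def)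
    ultimately show ?thesis unfolding good_def C by (auto intro!: exI[of _ "\<lambda>u. e (ix u)"])
  qed
  have "finite {A. good A}" using fin by (auto simp: good_def intro: finite_subset[of _ "Pow V"])
  moreover have "good {}" by (simp add: good_def)
  ultimately obtain A where A: "good A" and max: "\<And>B. good B \<Longrightarrow> A \<subseteq> B \<Longrightarrow> A = B"
    using finite_has_maximal[of "{A. good A}"] by blast
  from A obtain \<phi> where AV: "A \<subseteq> V" and \<phi>: "inj_on \<phi> A"
    "\<And>v. v \<in> A \<Longrightarrow> v \<in> \<phi> v \<and> \<phi> v \<in> edges H \<and> \<phi> v \<subseteq> A"
    unfolding good_def by blast
  have closed: "b \<in> A" if "a \<in> A" "{a, b} \<in> edges H" for a b
  proof (rule ccontr)
    assume b: "b \<notin> A"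
    have new: "{a, b} \<notin> \<phi> ` A"
    proof
      assume "{a, b} \<in> \<phi> ` A"
      then obtain u where "u \<in> A" "\<phi> u = {a, b}" by auto
      then show False using \<phi>(2)[of u] b by auto
    qed
    then have "inj_on (\<phi>(b := {a, b})) A" using \<phi>(1) by (rule inj_on_fun_updI[rotated])
    then have "inj_on (\<phi>(b := {a, b})) (insert b A)"
      using new b by (auto simp: inj_on_insert)
    moreover have "b \<in> V" using that(2) EH by (auto simp: nsets_def)
    ultimately have "good (insert b A)"
      unfolding good_def using \<phi> b AV that by (intro conjI exI[of _ "\<phi>(b := {a, b})"]) auto
    from max[OF this] b show False by blast
  qed
  have "A = V"
  proof (rule ccontr)
    assume "A \<noteq> V"
    then obtain v where v: "v \<in> V" "v \<notin> A" using AV by blast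
    let ?K = "induced_subgraph H (connected_rel H `` {v})"
    have "?K \<in> components H" using v VH by (auto simp: components_def quotient_def)
    then obtain C where C: "is_cycle C" "subgraph C ?K"
      using H unfolding unicyclic_subgraph_def by blast
    then have sub: "subgraph C H" and CW: "verts C \<subseteq> connected_rel H `` {v}"
      by (auto simp: subgraph_def induced_subgraph_def connected_rel_def)
    \<comment> \<open>Closedness keeps the whole component of \<open>v\<close> away from
      \<open>A\<close>. Its cycle is therefore disjoint from \<open>A\<close>, and the edge choices
      on the two sets can be combined.\<close>
    have "u \<notin> A" if "u \<in> connected_rel H `` {v}" for u
    proof -
      have "(v, u) \<in> {(x, y). {x, y} \<in> edges H}\<^sup>*" using that by (auto simp: connected_rel_def)
      then show ?thesis
      proof (induction rule: rtrancl_induct)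
        case (step y z)
        then show ?case using closed[of z y] by (auto simp: insert_commute)
      qed (rule v(2))
    qed
    then have disj: "verts C \<inter> A = {}" using CW by blast
    have "good (verts C)" using good_cycle C(1) sub by blast
    then obtain \<psi> where \<psi>: "verts C \<subseteq> V" "inj_on \<psi> (verts C)"
      "\<And>v. v \<in> verts C \<Longrightarrow> v \<in> \<psi> v \<and> \<psi> v \<in> edges H \<and> \<psi> v \<subseteq> verts C"
      unfolding good_def by blast
    let ?\<chi> = "\<lambda>v. if v \<in> A then \<phi> v else \<psi> v"
    have "inj_on ?\<chi> (A \<union> verts C)"
    proof (rule inj_onI)
      fix u w assume uw: "u \<in> A \<union> verts C" "w \<in> A \<union> verts C" "?\<chi> u = ?\<chi> w"
      have "\<phi> p \<noteq> \<psi> q" if "p \<in> A" "q \<in> verts C" for p q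
        using \<phi>(2)[of p] \<psi>(3)[of q] that disj by auto
      with uw show "u = w"
        using inj_onD[OF \<phi>(1), of u w] inj_onD[OF \<psi>(2), of u w] disj
        by (cases "u \<in> A"; cases "w \<in> A") (simp_all, metis+)
    qed
    then have "good (A \<union> verts C)"
      unfolding good_def using \<phi> \<psi> AV disj by (intro conjI exI[of _ ?\<chi>]) auto
    from max[OF this] have "verts C = {}" using disj by blast
    with C(1) show False by (auto simp: is_cycle_def)
  qed
  with \<phi> show ?thesis by blast
qed

section \<open>A Hall-type criterion for disjoint rainbow unicyclic subgraphs\<close>

text \<open>For finite \<open>Y\<close>, this is the rank of \<open>Y\<close> in the partition
  matroid whose independent sets contain each color at most \<open>t\<close> times.\<close>

definition capped :: "nat \<Rightarrow> ('e \<Rightarrow> 'k) \<Rightarrow> 'e set \<Rightarrow> nat" where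
  "capped t c Y = (\<Sum>k\<in>c ` Y. min t (card {e \<in> Y. c e = k}))"

lemma capped_superset:
  assumes "finite K" "c ` Y \<subseteq> K"
  shows "capped t c Y = (\<Sum>k\<in>K. min t (card {e \<in> Y. c e = k}))"
  unfolding capped_def
proof (rule sum.mono_neutral_left)
  show "\<forall>k\<in>K - c ` Y. min t (card {e \<in> Y. c e = k}) = 0"
  proof
    fix k assume "k \<in> K - c ` Y"
    then have "{e \<in> Y. c e = k} = {}" by auto
    then show "min t (card {e \<in> Y. c e = k}) = 0" by (metis card.empty min_0R)
  qed
qed (use assms in auto)

lemma capped_empty [simp]: "capped t c {} = 0"
  by (simp add: capped_def)

lemma capped_mono:
  assumes "finite Y" "X \<subseteq> Y"
  shows "capped t c X \<le> capped t c Y"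
proof -
  have "capped t c X = (\<Sum>k\<in>c ` Y. min t (card {e \<in> X. c e = k}))"
    by (rule capped_superset) (use assms in auto)
  also have "\<dots> \<le> capped t c Y" unfolding capped_def
  proof (rule sum_mono)
    fix k
    have "card {e \<in> X. c e = k} \<le> card {e \<in> Y. c e = k}" using assms by (intro card_mono) auto
    then show "min t (card {e \<in> X. c e = k}) \<le> min t (card {e \<in> Y. c e = k})" by linarith
  qed
  finally show ?thesis .
qed

text \<open>Color by color, this is concavity of \<open>min t\<close>: union and intersection have
  the same total class size as \<open>X\<close> and \<open>Y\<close>, only spread further
  apart.\<close>

lemma capped_submodular:
  assumes "finite X" "finite Y"
  shows "capped t c (X \<union> Y) + capped t c (X \<inter> Y) \<le> capped t c X + capped t c Y"
proof -
  let ?K = "c ` (X \<union> Y)" and ?n = "\<lambda>Z k. card {e \<in> Z. c e = k}"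
  have K: "finite ?K" using assms by simp
  have "min t (?n (X \<union> Y) k) + min t (?n (X \<inter> Y) k) \<le> min t (?n X k) + min t (?n Y k)" for k
  proof -
    have "{e \<in> X \<union> Y. c e = k} = {e \<in> X. c e = k} \<union> {e \<in> Y. c e = k}"
      "{e \<in> X \<inter> Y. c e = k} = {e \<in> X. c e = k} \<inter> {e \<in> Y. c e = k}" by auto
    then have "?n X k + ?n Y k = ?n (X \<union> Y) k + ?n (X \<inter> Y) k"
      using assms card_Un_Int[of "{e \<in> X. c e = k}" "{e \<in> Y. c e = k}"] by simp
    moreover have "?n (X \<inter> Y) k \<le> ?n X k" "?n (X \<inter> Y) k \<le> ?n Y k"
      using assms by (auto intro!: card_mono)
    ultimately show ?thesis by linarith
  qed
  then have le: "(\<Sum>k\<in>?K. min t (?n (X \<union> Y) k)) + (\<Sum>k\<in>?K. min t (?n (X \<inter> Y) k))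
      \<le> (\<Sum>k\<in>?K. min t (?n X k)) + (\<Sum>k\<in>?K. min t (?n Y k))"
    unfolding sum.distrib[symmetric] by (rule sum_mono)
  have "capped t c Z = (\<Sum>k\<in>?K. min t (?n Z k))" if "Z \<subseteq> X \<union> Y" for Z
    by (rule capped_superset) (use K that in auto)
  from this[of "X \<union> Y"] this[of "X \<inter> Y"] this[of X] this[of Y]
  have "capped t c (X \<union> Y) = (\<Sum>k\<in>?K. min t (?n (X \<union> Y) k))"
    "capped t c (X \<inter> Y) = (\<Sum>k\<in>?K. min t (?n (X \<inter> Y) k))"
    "capped t c X = (\<Sum>k\<in>?K. min t (?n X k))" "capped t c Y = (\<Sum>k\<in>?K. min t (?n Y k))"
    by blast+
  with le show ?thesis by (simp only:)
qed

lemma card_eq_sum_fibres: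
  assumes "finite Y"
  shows "card Y = (\<Sum>k\<in>c ` Y. card {e \<in> Y. c e = k})"
proof -
  have "card Y = card (\<Union>k\<in>c ` Y. {e \<in> Y. c e = k})" by (rule arg_cong[of _ _ card]) auto
  also have "\<dots> = (\<Sum>k\<in>c ` Y. card {e \<in> Y. c e = k})"
    by (rule card_UN_disjoint) (use assms in auto)
  finally show ?thesis .
qed

lemma capped_le_card: "finite Y \<Longrightarrow> capped t c Y \<le> card Y"
  unfolding capped_def by (subst card_eq_sum_fibres[of Y c]) (auto intro!: sum_mono)

lemma capped_le_colors: "capped t c Y \<le> t * card (c ` Y)"
proof -
  have "capped t c Y \<le> (\<Sum>k\<in>c ` Y. t)" unfolding capped_def by (rule sum_mono) simp
  then show ?thesis by (simp add: mult.commute)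
qed

text \<open>A color class above the cap would make the capped count strictly smaller than the plain
  one.\<close>

lemma fibre_le_if_capped:
  assumes fin: "finite Y" and le: "card Y \<le> capped t c Y"
  shows "card {e \<in> Y. c e = k} \<le> t"
proof (rule ccontr)
  assume no: "\<not> ?thesis"
  then have "{e \<in> Y. c e = k} \<noteq> {}" by (metis card.empty le0)
  then have "k \<in> c ` Y" by auto
  then have "capped t c Y < (\<Sum>k\<in>c ` Y. card {e \<in> Y. c e = k})"
    unfolding capped_def using fin no by (intro sum_strict_mono_ex1 bexI[of _ k]) (auto simp: not_le)
  then show False using le card_eq_sum_fibres[OF fin, of c] by simp
qed

text \<open>The large class contributes the full \<open>t\<close>, and every other color present
  contributes at least 1.\<close>

lemma capped_large_class:
  assumes fin: "finite Y" and "1 \<le> t" and k: "t < card {e \<in> Y. c e = k}"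
  shows "t + (card (c ` Y) - 1) \<le> capped t c Y"
proof -
  have "{e \<in> Y. c e = k} \<noteq> {}" using k by (metis card.empty not_less0)
  then have kY: "k \<in> c ` Y" by auto
  have "card (c ` Y) - 1 = (\<Sum>j\<in>c ` Y - {k}. 1)" using kY fin by simp
  also have "\<dots> \<le> (\<Sum>j\<in>c ` Y - {k}. min t (card {e \<in> Y. c e = j}))"
  proof (rule sum_mono)
    fix j assume "j \<in> c ` Y - {k}"
    then have "{e \<in> Y. c e = j} \<noteq> {}" by auto
    then have "0 < card {e \<in> Y. c e = j}" using fin by (simp add: card_gt_0_iff)
    then show "1 \<le> min t (card {e \<in> Y. c e = j})" using \<open>1 \<le> t\<close> by linarith
  qed
  finally have "t + (card (c ` Y) - 1) \<le>
      min t (card {e \<in> Y. c e = k}) + (\<Sum>j\<in>c ` Y - {k}. min t (card {e \<in> Y. c e = j}))"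
    using k by simp
  also have "\<dots> = capped t c Y" unfolding capped_def using kY fin by (simp add: sum.remove)
  finally show ?thesis .
qed

section \<open>Edges meeting a vertex set\<close>

definition incident :: "'a set \<Rightarrow> 'a set \<Rightarrow> 'a set set" where
  "incident V X = {e \<in> nsets V 2. e \<inter> X \<noteq> {}}"

lemma finite_incident: "finite V \<Longrightarrow> finite (incident V X)"
  by (simp add: incident_def finite_imp_finite_nsets)

lemma nsets_split: "nsets V 2 = incident V X \<union> nsets (V - X) 2" "incident V X \<inter> nsets (V - X) 2 = {}"
  by (auto simp: incident_def nsets_def)

lemma nsets_2_card: "finite V \<Longrightarrow> card (nsets V 2) = card V choose 2"
  unfolding nsets_def using n_subsets[of V 2] by (metis (no_types, lifting) Collect_cong finite_subset)

lemma card_incident: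
  assumes "finite V" "X \<subseteq> V"
  shows "card (incident V X) + ((card V - card X) choose 2) = card V choose 2"
proof -
  have "card (V - X) = card V - card X" using assms by (simp add: card_Diff_subset finite_subset)
  moreover have "card (nsets V 2) = card (incident V X) + card (nsets (V - X) 2)"
    using assms nsets_split[of V X]
    by (metis card_Un_disjoint finite_Diff finite_imp_finite_nsets finite_incident)
  ultimately show ?thesis using assms by (simp add: nsets_2_card)
qed

text \<open>For necessity, edge choices in the \<open>t\<close> subgraphs embed
  \<open>{..<t} \<times> X\<close> into the incident edges with every color used at most
  \<open>t\<close> times. For sufficiency, each vertex gets \<open>t\<close> slots, Rado's theorem
  fills them, and Koenig's theorem distributes them over \<open>t\<close> subgraphs.\<close>

theorem disjoint_rainbow_unicyclics_iff:
  fixes c :: "'a set \<Rightarrow> nat"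
  assumes fin: "finite V"
  shows "has_disjoint_rainbow_unicyclics (complete_graph V) c t \<longleftrightarrow>
    (\<forall>X\<subseteq>V. t * card X \<le> capped t c (incident V X))" (is "?L \<longleftrightarrow> ?R")
proof
  assume ?L
  then obtain H where H: "\<And>i. i < t \<Longrightarrow> unicyclic_subgraph (H i) (complete_graph V) \<and> rainbow c (H i)"
    and disj: "disjoint_family_on (\<lambda>i. edges (H i)) {..<t}"
    unfolding has_disjoint_rainbow_unicyclics_def by blast
  have "\<exists>\<phi>. inj_on \<phi> V \<and> (\<forall>v\<in>V. \<phi> v \<in> edges (H i) \<and> v \<in> \<phi> v)" if "i < t" for i
    using edge_choice_if_unicyclic[OF fin] H[OF that] by blast
  then obtain \<phi> where \<phi>: "\<And>i. i < t \<Longrightarrow> inj_on (\<phi> i) V"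
    "\<And>i v. i < t \<Longrightarrow> v \<in> V \<Longrightarrow> \<phi> i v \<in> edges (H i) \<and> v \<in> \<phi> i v" by metis
  show ?R
  proof (intro allI impI)
    fix X assume XV: "X \<subseteq> V"
    have finX: "finite X" using XV fin finite_subset by blast
    let ?P = "{..<t} \<times> X" and ?Y = "incident V X"
    define g where "g = (\<lambda>(i, v). \<phi> i v)"
    have gY: "g ` ?P \<subseteq> ?Y"
    proof -
      have "edges (H i) \<subseteq> nsets V 2" if "i < t" for i
        using H[OF that]
        by (auto simp: unicyclic_subgraph_def spanning_subgraph_def subgraph_def complete_graph_def)
      then show ?thesis using \<phi>(2) XV by (fastforce simp: g_def incident_def)
    qed
    have same: "i = j" if "i < t" "j < t" "\<phi> i u = \<phi> j w" "u \<in> X" "w \<in> X" for i j u w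
    proof (rule ccontr)
      assume "i \<noteq> j"
      then have "edges (H i) \<inter> edges (H j) = {}"
        using disj that(1,2) by (simp add: disjoint_family_on_def)
      moreover have "\<phi> i u \<in> edges (H i)" "\<phi> j w \<in> edges (H j)"
        using \<phi>(2)[of i u] \<phi>(2)[of j w] that XV by auto
      ultimately show False using that(3) by auto
    qed
    have g_inj: "inj_on g ?P"
    proof (rule inj_onI)
      fix p q assume pq: "p \<in> ?P" "q \<in> ?P" "g p = g q"
      obtain i u j w where "p = (i, u)" "q = (j, w)" by (cases p, cases q)
      then show "p = q"
        using pq same[of i j u w] inj_onD[OF \<phi>(1), of i u w] XV by (auto simp: g_def)
    qed
    have "t * card X = card ?P" by (simp add: card_cartesian_product)
    also have "\<dots> = (\<Sum>k\<in>(\<lambda>p. c (g p)) ` ?P. card {p \<in> ?P. c (g p) = k})"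
      by (rule card_eq_sum_fibres) (use finX in simp)
    also have "\<dots> \<le> (\<Sum>k\<in>(\<lambda>p. c (g p)) ` ?P. min t (card {e \<in> ?Y. c e = k}))"
    proof (rule sum_mono)
      fix k
      let ?F = "{p \<in> ?P. c (g p) = k}"
      have "card ?F \<le> card {e \<in> ?Y. c e = k}"
        by (rule card_inj_on_le[where f = g])
          (use g_inj gY finite_incident[OF fin] in \<open>auto intro: inj_on_subset\<close>)
      \<comment> \<open>A rainbow subgraph has at most one edge of color \<open>k\<close>, so each
        index \<open>i\<close> occurs at most once.\<close>
      moreover have "inj_on fst ?F"
      proof (rule inj_onI)
        fix p q assume pq: "p \<in> ?F" "q \<in> ?F" "fst p = fst q"
        obtain i u w where p: "p = (i, u)" "q = (i, w)" using pq(3) by (cases p, cases q) auto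
        then have i: "i < t" and "u \<in> V" "w \<in> V" and cc: "c (\<phi> i u) = c (\<phi> i w)"
          using pq XV by (auto simp: g_def)
        then have "\<phi> i u = \<phi> i w"
          using H[OF i] \<phi>(2)[OF i] unfolding rainbow_def by (meson inj_onD)
        then show "p = q" using p inj_onD[OF \<phi>(1)[OF i]] \<open>u \<in> V\<close> \<open>w \<in> V\<close> by auto
      qed
      then have "card ?F \<le> card {..<t}" by (rule card_inj_on_le) auto
      ultimately show "card ?F \<le> min t (card {e \<in> ?Y. c e = k})" by simp
    qed
    also have "\<dots> \<le> capped t c ?Y"
      unfolding capped_def using gY finite_incident[OF fin] by (intro sum_mono2) auto
    finally show "t * card X \<le> capped t c ?Y" .
  qed
next
  assume R: ?R
  let ?J = "V \<times> {..<t}"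
  have "\<exists>x. (\<forall>j\<in>?J. x j \<in> incident V {fst j}) \<and> card ?J \<le> capped t c (x ` ?J)"
  proof (rule rado_transversal)
    fix K assume K: "K \<subseteq> ?J"
    have finK: "finite (fst ` K)" using K fin by (meson finite_SigmaI finite_imageI finite_lessThan finite_subset)
    \<comment> \<open>Taking all slots of the vertices that occur in \<open>K\<close> keeps the
      union of the sets and only enlarges the family, so a condition on vertex sets
      suffices.\<close>
    have "card K \<le> card (fst ` K \<times> {..<t})"
    proof (rule card_mono)
      show "K \<subseteq> fst ` K \<times> {..<t}"
      proof
        fix p assume "p \<in> K"
        then have "fst p \<in> fst ` K" "snd p < t" using K by auto
        then show "p \<in> fst ` K \<times> {..<t}" by (simp add: mem_Times_iff)
      qed
    qed (use finK in simp)
    also have "\<dots> = t * card (fst ` K)" by (simp add: card_cartesian_product)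
    also have "\<dots> \<le> capped t c (incident V (fst ` K))"
    proof -
      have "fst ` K \<subseteq> V" using K by auto
      with R show ?thesis by blast
    qed
    also have "incident V (fst ` K) = (\<Union>j\<in>K. incident V {fst j})" by (auto simp: incident_def)
    finally show "card K \<le> capped t c (\<Union>j\<in>K. incident V {fst j})" .
  qed (use fin in \<open>auto intro: capped_mono capped_submodular finite_incident\<close>)
  then obtain x where x: "\<And>j. j \<in> ?J \<Longrightarrow> x j \<in> incident V {fst j}"
    and big: "card ?J \<le> capped t c (x ` ?J)" by blast
  have finJ: "finite ?J" using fin by simp
  \<comment> \<open>The capped count is at most the size of the image, which is at most
    \<open>card ?J\<close>; equality throughout makes \<open>x\<close> injective.\<close>
  have x_inj: "inj_on x ?J"
    using big capped_le_card[of "x ` ?J" t c] card_image_le[OF finJ, of x] finJ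
    by (intro eq_card_imp_inj_on) auto
  have "card {j \<in> ?J. fst j = v} \<le> t" for v
  proof -
    have "card {j \<in> ?J. fst j = v} \<le> card {..<t}"
      by (rule card_inj_on_le[where f = snd]) (auto simp: inj_on_def)
    then show ?thesis by simp
  qed
  moreover have "card {j \<in> ?J. c (x j) = k} \<le> t" for k
  proof -
    have "card {j \<in> ?J. c (x j) = k} \<le> card {e \<in> x ` ?J. c e = k}"
      by (rule card_inj_on_le[where f = x]) (use x_inj finJ in \<open>auto intro: inj_on_subset\<close>)
    also have "\<dots> \<le> t"
      by (rule fibre_le_if_capped) (use finJ big card_image[OF x_inj] in auto)
    finally show ?thesis .
  qed
  \<comment> \<open>Slots are the edges of a bipartite multigraph joining vertices to colors; the
    label of a slot tells to which subgraph it goes.\<close>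
  ultimately have "\<exists>l. \<forall>p\<in>?J. l p < t \<and>
      (\<forall>q\<in>?J. p \<noteq> q \<longrightarrow> l p = l q \<longrightarrow> fst p \<noteq> fst q \<and> c (x p) \<noteq> c (x q))"
    using bipartite_edge_coloring[OF finJ, of fst t "\<lambda>j. c (x j)"] by blast
  then obtain l where l: "\<And>p. p \<in> ?J \<Longrightarrow> l p < t"
    "\<And>p q. p \<in> ?J \<Longrightarrow> q \<in> ?J \<Longrightarrow> p \<noteq> q \<Longrightarrow> l p = l q \<Longrightarrow> fst p \<noteq> fst q \<and> c (x p) \<noteq> c (x q)"
    by metis
  \<comment> \<open>The \<open>t\<close> slots of a vertex bear distinct labels below
    \<open>t\<close>, so each label occurs and every subgraph receives an edge from every
    vertex.\<close>
  have "\<exists>m<t. l (v, m) = i" if "v \<in> V" "i < t" for v i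
  proof -
    have "inj_on (\<lambda>m. l (v, m)) {..<t}"
    proof (rule inj_onI)
      fix a b assume "a \<in> {..<t}" "b \<in> {..<t}" "l (v, a) = l (v, b)"
      then show "a = b" using l(2)[of "(v, a)" "(v, b)"] that(1) by auto
    qed
    moreover have "(\<lambda>m. l (v, m)) ` {..<t} \<subseteq> {..<t}" using l(1) that(1) by auto
    ultimately have "(\<lambda>m. l (v, m)) ` {..<t} = {..<t}" by (simp add: endo_inj_surj)
    then have "i \<in> (\<lambda>m. l (v, m)) ` {..<t}" using that(2) by simp
    then show ?thesis by auto
  qed
  then obtain m where m: "\<And>v i. v \<in> V \<Longrightarrow> i < t \<Longrightarrow> m v i < t \<and> l (v, m v i) = i" by metis
  define \<phi> where "\<phi> i v = x (v, m v i)" for i v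
  have J: "(v, m v i) \<in> ?J" if "v \<in> V" "i < t" for v i using m that by simp
  have \<phi>_inj: "v = w \<and> i = j" if "\<phi> i v = \<phi> j w" "v \<in> V" "w \<in> V" "i < t" "j < t" for i j v w
  proof -
    have eq: "(v, m v i) = (w, m w j)" using inj_onD[OF x_inj] J that by (auto simp: \<phi>_def)
    then have "l (v, m v i) = l (w, m w j)" by (rule arg_cong)
    moreover have "l (v, m v i) = i" "l (w, m w j) = j" using m that by auto
    ultimately show ?thesis using eq by (metis prod.inject)
  qed
  show ?L
    unfolding has_disjoint_rainbow_unicyclics_def
  proof (intro exI[of _ "\<lambda>i. (V, \<phi> i ` V)"] conjI allI impI)
    fix i assume i: "i < t"
    show "unicyclic_subgraph (V, \<phi> i ` V) (complete_graph V)"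
    proof (rule unicyclic_if_edge_choice[OF fin])
      show "inj_on (\<phi> i) V" using \<phi>_inj i by (auto simp: inj_on_def)
      show "\<phi> i v \<in> nsets V 2 \<and> v \<in> \<phi> i v" if "v \<in> V" for v
        using x[OF J[OF that i]] by (auto simp: \<phi>_def incident_def)
    qed
    show "rainbow c (V, \<phi> i ` V)"
      unfolding rainbow_def
    proof (rule inj_onI)
      fix d e assume "d \<in> edges (V, \<phi> i ` V)" "e \<in> edges (V, \<phi> i ` V)" and cde: "c d = c e"
      then obtain v w where vw: "v \<in> V" "w \<in> V" "d = \<phi> i v" "e = \<phi> i w" by auto
      then show "d = e"
        using l(2)[OF J[OF vw(1) i] J[OF vw(2) i]] cde m i by (auto simp: \<phi>_def)
    qed
  next
    show "disjoint_family_on (\<lambda>i. edges (V, \<phi> i ` V)) {..<t}"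
      unfolding disjoint_family_on_def using \<phi>_inj by fastforce
  qed
qed

section \<open>The anti-Ramsey number\<close>

text \<open>The edges avoiding \<open>X\<close> and all but one of the desired further colors are
  made singletons, and the remaining edges share one color. The capped count at \<open>X\<close> is
  then at most \<open>t * (card X - 1) - 1 + t\<close>, one short of what is required.\<close>

lemma extremal_coloring:
  assumes fin: "finite V" and XV: "X \<subseteq> V" and "1 \<le> t" and "2 \<le> card X"
    and le: "t * (card X - 1) \<le> card (incident V X)"
  shows "\<exists>c :: 'a set \<Rightarrow> nat. card (c ` nsets V 2) = ((card V - card X) choose 2) + t * (card X - 1) \<and>
    \<not> has_disjoint_rainbow_unicyclics (complete_graph V) c t"
proof -
  let ?Y = "incident V X" and ?Z = "nsets (V - X) 2"
  have pos: "1 \<le> t * (card X - 1)" using \<open>1 \<le> t\<close> \<open>2 \<le> card X\<close> by simp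
  obtain S where S: "S \<subseteq> ?Y" "card S = t * (card X - 1) - 1" "finite S"
    using obtain_subset_with_card_n[of "t * (card X - 1) - 1" ?Y] le by (metis diff_le_self le_trans)
  define U where "U = ?Z \<union> S"
  have finY: "finite ?Y" and finZ: "finite ?Z"
    using fin by (auto intro: finite_incident finite_imp_finite_nsets)
  have finU: "finite U" using S finZ by (simp add: U_def)
  have cU: "card U = ((card V - card X) choose 2) + (t * (card X - 1) - 1)"
  proof -
    have "card U = card ?Z + card S" unfolding U_def
      by (rule card_Un_disjoint) (use finZ S nsets_split(2)[of V X] in auto)
    moreover have "card (V - X) = card V - card X" using fin XV by (simp add: card_Diff_subset finite_subset)
    ultimately show ?thesis using S(2) fin by (simp add: nsets_2_card)
  qed
  obtain h :: "'a set \<Rightarrow> nat" where h: "inj_on h U" using finite_imp_inj_to_nat_seg[OF finU] by blast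
  \<comment> \<open>Shifting by \<open>Suc\<close> reserves the color 0 for the shared
    class.\<close>
  define c where "c e = (if e \<in> U then Suc (h e) else 0)" for e
  have "card S < card ?Y" using S(2) le pos by linarith
  \<comment> \<open>The shared color really occurs, which makes up for the 1 subtracted in the size
    of \<open>S\<close>.\<close>
  then obtain e0 where e0: "e0 \<in> ?Y" "e0 \<notin> S" using S(1) by (metis less_irrefl subset_antisym subsetI)
  then have "e0 \<notin> U" using nsets_split(2)[of V X] by (auto simp: U_def)
  have UE: "U \<subseteq> nsets V 2" using S(1) nsets_split(1)[of V X] by (auto simp: U_def)
  have "e0 \<in> nsets V 2" using e0 by (simp add: incident_def)
  then have "c ` nsets V 2 = insert 0 ((\<lambda>e. Suc (h e)) ` U)"
    using UE \<open>e0 \<notin> U\<close> by (force simp: c_def)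
  moreover have "card ((\<lambda>e. Suc (h e)) ` U) = card U"
    using h by (intro card_image) (simp add: inj_on_def)
  ultimately have cc: "card (c ` nsets V 2) = ((card V - card X) choose 2) + t * (card X - 1)"
  proof -
    assume "c ` nsets V 2 = insert 0 ((\<lambda>e. Suc (h e)) ` U)" "card ((\<lambda>e. Suc (h e)) ` U) = card U"
    then have "card (c ` nsets V 2) = Suc (card U)" using finU by (simp add: card_insert_if image_iff)
    then show ?thesis using cU pos by linarith
  qed
  have Y_eq: "?Y = S \<union> (?Y - S)" using S(1) by auto
  have "capped t c ?Y \<le> capped t c S + capped t c (?Y - S)"
    using capped_submodular[of S "?Y - S" t c] finY S(3) Y_eq by simp
  also have "\<dots> \<le> card S + t * 1"
  proof (rule add_mono)
    show "capped t c S \<le> card S" using S(3) by (rule capped_le_card)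
    have "c ` (?Y - S) \<subseteq> {0}" using nsets_split(2)[of V X] by (auto simp: c_def U_def)
    then have "card (c ` (?Y - S)) \<le> 1" using card_mono[of "{0}" "c ` (?Y - S)"] by simp
    then show "capped t c (?Y - S) \<le> t * 1"
      using capped_le_colors[of t c "?Y - S"] by (meson le_trans mult_le_mono2)
  qed
  also have "\<dots> < t * (card X - 1) + t" using S(2) pos by linarith
  also have "\<dots> = t * card X" using \<open>2 \<le> card X\<close> by (cases "card X") auto
  finally have "\<not> has_disjoint_rainbow_unicyclics (complete_graph V) c t"
    using XV by (auto simp: disjoint_rainbow_unicyclics_iff[OF fin] not_le)
  with cc show ?thesis by blast
qed

section \<open>Counting estimates and the value of the anti-Ramsey number\<close>

lemma double_choose_two: "2 * (n choose 2) = n * (n - 1)" for n :: nat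
  by (cases n) (simp_all add: choose_two)

text \<open>Each vertex has degree \<open>card V - 1 \<ge> 2 * t\<close>, and an edge is counted at
  most twice. The computation subtracts the edges avoiding \<open>X\<close>, doubled to clear the
  binomials.\<close>

lemma card_incident_ge:
  assumes fin: "finite V" and XV: "X \<subseteq> V" and n: "2 * t < card V"
  shows "t * card X \<le> card (incident V X)"
proof -
  have "card X \<le> card V" using assms by (simp add: card_mono)
  then obtain a where a: "card V = card X + a" using le_Suc_ex by blast
  define k where "k = card X"
  have eq: "2 * card (incident V X) + a * (a - 1) = (k + a) * (k + a - 1)"
    using card_incident[OF fin XV] double_choose_two[of a] double_choose_two[of "k + a"]
    by (simp add: a k_def)
  have "2 * (t * k) + a * (a - 1) \<le> (k + a) * (k + a - 1)"
  proof -
    have "k * (2 * t) \<le> k * (k + a - 1)" using n a by (intro mult_le_mono2) (simp add: k_def)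
    moreover have "a * (a - 1) \<le> a * (k + a - 1)" by (intro mult_le_mono2) linarith
    moreover have "k * (2 * t) = 2 * (t * k)" by simp
    moreover have "(k + a) * (k + a - 1) = k * (k + a - 1) + a * (k + a - 1)" by (rule add_mult_distrib)
    ultimately show ?thesis by linarith
  qed
  with eq show ?thesis by (simp add: k_def)
qed

text \<open>If no color exceeds \<open>t\<close> at \<open>X\<close>, the degree count suffices.
  Otherwise a large class contributes \<open>t\<close>; for \<open>card X \<ge> 2\<close>, removing
  the colors that can occur off \<open>X\<close> leaves more than \<open>t * (card X - 1)\<close>
  colors at \<open>X\<close>.\<close>

lemma many_colors_imp_disjoint_rainbow_unicyclics:
  fixes c :: "'a set \<Rightarrow> nat"
  assumes fin: "finite V" and n: "2 * t < card V" and "1 \<le> t"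
    and colors: "\<And>k. 2 \<le> k \<Longrightarrow> k \<le> card V \<Longrightarrow>
      ((card V - k) choose 2) + t * (k - 1) < card (c ` nsets V 2)"
  shows "has_disjoint_rainbow_unicyclics (complete_graph V) c t"
  unfolding disjoint_rainbow_unicyclics_iff[OF fin]
proof (intro allI impI)
  fix X assume XV: "X \<subseteq> V"
  let ?Y = "incident V X"
  have finY: "finite ?Y" using fin by (rule finite_incident)
  show "t * card X \<le> capped t c ?Y"
  proof (cases "\<exists>k. t < card {e \<in> ?Y. c e = k}")
    case False
    then have "capped t c ?Y = card ?Y"
      unfolding capped_def card_eq_sum_fibres[OF finY, of c] by (intro sum.cong) (auto simp: not_less)
    then show ?thesis using card_incident_ge[OF fin XV n] by simp
  next
    case True
    then have big: "t + (card (c ` ?Y) - 1) \<le> capped t c ?Y"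
      using capped_large_class[OF finY \<open>1 \<le> t\<close>, of c] by blast
    show ?thesis
    proof (cases "2 \<le> card X")
      case True
      have "card (c ` nsets V 2) \<le> card (c ` ?Y) + card (c ` nsets (V - X) 2)"
        using nsets_split(1)[of V X] by (metis card_Un_le image_Un)
      also have "card (c ` nsets (V - X) 2) \<le> card (nsets (V - X) 2)"
        using fin by (intro card_image_le finite_imp_finite_nsets) simp
      also have "\<dots> = (card V - card X) choose 2"
        using fin XV by (simp add: nsets_2_card card_Diff_subset finite_subset)
      finally have "t * (card X - 1) < card (c ` ?Y)"
        using colors[of "card X"] True card_mono[OF fin XV] by linarith
      moreover have "t * card X = t + t * (card X - 1)" using True by (cases "card X") auto
      ultimately show ?thesis using big by linarith
    next
      case False
      then have "t * card X \<le> t * 1" by (intro mult_le_mono2) simp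
      then show ?thesis using big by linarith
    qed
  qed
qed

text \<open>The left side is convex in \<open>k\<close>, so its maximum is at \<open>k = 2\<close>
  or \<open>k = n\<close>; these are the two assumed bounds.\<close>

lemma choose_two_plus_linear_le:
  fixes n k t :: nat
  assumes "2 \<le> k" "k \<le> n" and f1: "((n - 2) choose 2) + t \<le> f" and f2: "t * (n - 1) \<le> f"
  shows "((n - k) choose 2) + t * (k - 1) \<le> f"
proof -
  obtain a where a: "n = k + a" using assms le_Suc_ex by blast
  obtain d where d: "k = d + 2" using assms by (metis add.commute le_Suc_ex)
  show ?thesis
  \<comment> \<open>For small \<open>a = n - k\<close> one compares with the end
    \<open>k = n\<close>, using \<open>a choose 2 \<le> t * a\<close>; for large \<open>a\<close>,
    with the end \<open>k = 2\<close>.\<close>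
  proof (cases "a - 1 \<le> 2 * t")
    case True
    then have "a * (a - 1) \<le> a * (2 * t)" by (rule mult_le_mono2)
    also have "\<dots> = 2 * (t * a)" by simp
    finally have "a choose 2 \<le> t * a" using double_choose_two[of a] by linarith
    then have "(a choose 2) + t * (k - 1) \<le> t * (n - 1)" by (simp add: a d algebra_simps)
    then show ?thesis using f2 a by simp
  next
    case False
    have "2 * (t * d) + a * (a - 1) \<le> (d + a) * (d + a - 1)"
    proof -
      have "d * (2 * t) \<le> d * (d + a - 1)" using False by (intro mult_le_mono2) linarith
      moreover have "a * (a - 1) \<le> a * (d + a - 1)" by (intro mult_le_mono2) linarith
      moreover have "d * (2 * t) = 2 * (t * d)" by simp
      moreover have "(d + a) * (d + a - 1) = d * (d + a - 1) + a * (d + a - 1)" by (rule add_mult_distrib)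
      ultimately show ?thesis by linarith
    qed
    then have "(a choose 2) + t * d \<le> (d + a) choose 2"
      using double_choose_two[of a] double_choose_two[of "d + a"] by linarith
    then show ?thesis using f1 by (simp add: a d)
  qed
qed

theorem theorem15:
  fixes V :: "'a set" and n t :: nat
  assumes "finite V" and "card V = n" and "n \<ge> 3" and "t \<ge> 1"
  shows "ar_bc (complete_graph V) t =
    (if n \<le> 2 * t then n choose 2
     else if n \<le> 2 * t + 3 then t * (n - 1)
     else ((n - 2) choose 2) + t)"
proof -
  let ?f = "if n \<le> 2 * t then n choose 2
     else if n \<le> 2 * t + 3 then t * (n - 1)
     else ((n - 2) choose 2) + t"
  let ?E = "nsets V 2" and ?B = "\<lambda>c :: 'a set \<Rightarrow> nat. has_disjoint_rainbow_unicyclics (complete_graph V) c t"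
  have finE: "finite ?E" using assms(1) by (rule finite_imp_finite_nsets)
  have cE: "card ?E = n choose 2" using assms by (simp add: nsets_2_card)
  have E: "edges (complete_graph V) = ?E" by (simp add: complete_graph_def)
  have le_E: "card (c ` ?E) \<le> n choose 2" for c :: "'a set \<Rightarrow> nat"
    using card_image_le[OF finE, of c] cE by simp
  \<comment> \<open>Twice the difference of the two candidate values is
    \<open>(n - 2) * (n - 3 - 2 * t)\<close> over the integers, so they change order at
    \<open>n = 2 * t + 3\<close>.\<close>
  have cmp: "2 * ((n - 2) choose 2) = (n - 2) * (n - 3)" "2 * (t * (n - 2)) = (n - 2) * (2 * t)"
    "t * (n - 1) = t * (n - 2) + t"
  proof -
    show "2 * ((n - 2) choose 2) = (n - 2) * (n - 3)" using double_choose_two[of "n - 2"] by simp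
    have "n - 1 = Suc (n - 2)" using assms(3) by simp
    then show "t * (n - 1) = t * (n - 2) + t" by simp
  qed simp
  \<comment> \<open>Beyond \<open>2 * t\<close> vertices, the claimed value is the larger of the two
    candidates, so it dominates the color thresholds for all \<open>k\<close>.\<close>
  have upper: "card (c ` ?E) \<le> ?f" if "\<not> ?B c" for c
  proof (cases "n \<le> 2 * t")
    case True
    then show ?thesis using le_E by simp
  next
    case False
    show ?thesis
    proof (rule ccontr)
      assume gt: "\<not> ?thesis"
      have f1: "((n - 2) choose 2) + t \<le> ?f"
      proof (cases "n \<le> 2 * t + 3")
        case True
        then have "(n - 2) * (n - 3) \<le> (n - 2) * (2 * t)" by (intro mult_le_mono2) simp
        then have "((n - 2) choose 2) + t \<le> t * (n - 1)" using cmp by linarith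
        then show ?thesis using True False by simp
      qed (use False in simp)
      have f2: "t * (n - 1) \<le> ?f"
      proof (cases "n \<le> 2 * t + 3")
        case F: False
        then have "(n - 2) * (2 * t) \<le> (n - 2) * (n - 3)" by (intro mult_le_mono2) simp
        then have "t * (n - 1) \<le> ((n - 2) choose 2) + t" using cmp by linarith
        then show ?thesis using F False by simp
      qed (use False in simp)
      have "?B c"
      proof (rule many_colors_imp_disjoint_rainbow_unicyclics)
        fix k assume "2 \<le> k" "k \<le> card V"
        then show "((card V - k) choose 2) + t * (k - 1) < card (c ` ?E)"
          using choose_two_plus_linear_le[OF _ _ f1 f2, of k] gt assms(2) by simp
      qed (use assms False in auto)
      with that show False by blast
    qed
  qed
  have attained: "\<exists>c. card (c ` ?E) = ?f \<and> \<not> ?B c"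
  proof (cases "n \<le> 2 * t")
    case True
    obtain c :: "'a set \<Rightarrow> nat" where c: "inj_on c ?E" using finite_imp_inj_to_nat_seg[OF finE] by blast
    \<comment> \<open>Even with all colors distinct, \<open>t\<close> disjoint unicyclic subgraphs
      need \<open>t * n\<close> edges, more than the graph has.\<close>
    have "\<not> ?B c"
    proof
      assume "?B c"
      then have "t * n \<le> capped t c (incident V V)"
        using disjoint_rainbow_unicyclics_iff[OF assms(1)] assms(2) by blast
      also have "\<dots> \<le> card (incident V V)"
        using assms(1) by (intro capped_le_card finite_incident)
      also have "\<dots> \<le> card ?E" using finE by (intro card_mono) (auto simp: incident_def)
      finally have "2 * (t * n) \<le> n * (n - 1)" using cE double_choose_two[of n] by linarith
      then have "n * (2 * t) \<le> n * (n - 1)" by (simp add: ac_simps)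
      then have "2 * t \<le> n - 1" using assms(3) by simp
      then show False using True assms(3) by linarith
    qed
    then show ?thesis using True card_image[OF c] cE by auto
  next
    case big: False
    show ?thesis
    proof (cases "n \<le> 2 * t + 3")
      case True
      \<comment> \<open>In the middle range the obstruction is \<open>X = V\<close>, with no edges
        avoiding it.\<close>
      have "t * n \<le> card (incident V V)"
        using card_incident_ge[of V V t] assms big by simp
      then have "t * (card V - 1) \<le> card (incident V V)"
        using assms(2) by (meson diff_le_self le_trans mult_le_mono2)
      then show ?thesis
        using extremal_coloring[of V V t] assms True big by (auto simp: binomial_eq_0)
    next
      case False
      \<comment> \<open>For large \<open>n\<close> the obstruction is a pair of vertices.\<close>
      obtain X where X: "X \<subseteq> V" "card X = 2"
        using obtain_subset_with_card_n[of 2 V] assms by auto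
      have "t * (card X - 1) \<le> card (incident V X)"
        using card_incident_ge[OF assms(1) X(1), of t] assms big X(2) by simp
      then show ?thesis using extremal_coloring[of V X t] X assms False big by auto
    qed
  qed
  show ?thesis
    unfolding ar_bc_def E
  proof (rule Max_eqI)
    show "finite {m. \<exists>c. card (c ` ?E) = m \<and> \<not> ?B c}"
      by (rule finite_subset[of _ "{..n choose 2}"]) (use le_E in auto)
  qed (use upper attained in auto)
qed

end
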